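(* Let $T$ be a reduced tree with at least $5$ vertices, and let $M$ be the set of good pendant edges of $T$. Then $T$ is well-indumatched if and only if every edge of $T$ is covered by exactly one edge of $M$.
   Context: All graphs are finite, simple and undirected. An induced matching of a graph $G$ is a set $M$ of edges, no two sharing an endpoint, such that no edge of $G$ joins an endpoint of one edge of $M$ to an endpoint of another edge of $M$. A graph is well-indumatched if all of its inclusion-wise maximal induced matchings have the same size. The distance between two edges $e_1,e_2$ is the minimum distance between an endpoint of $e_1$ and an endpoint of $e_2$; $e_1$ covers $e_2$ if this distance is at most $1$ (in particular every edge covers itself). A graph is reduced if no two distinct vertices have the same set of neighbors. A pendant edge is an edge incident with a vertex of degree $1$; a good pendant edge is a pendant edge whose other endpoint has degree $2$. *)

theory Defs
  imports Main "HOL-Library.Extended_Nat"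
begin

text \<open>
  A graph is given by its vertex set \<open>V\<close> and its set \<open>E\<close> of edges, which are two-element sets of
  vertices. The AFP entry Graph_Theory models undirected graphs as symmetric digraphs, in which
  every pair of opposite arcs is a cycle, so that its notion of tree does not apply here.
\<close>

definition simple_graph :: "'a set \<Rightarrow> 'a set set \<Rightarrow> bool" where
  "simple_graph V E \<longleftrightarrow> finite V \<and> (\<forall>e\<in>E. e \<subseteq> V \<and> card e = 2)"

definition neighbors :: "'a set \<Rightarrow> 'a set set \<Rightarrow> 'a \<Rightarrow> 'a set" where
  "neighbors V E v = {u \<in> V. {v, u} \<in> E}"

definition vdegree :: "'a set \<Rightarrow> 'a set set \<Rightarrow> 'a \<Rightarrow> nat" where
  "vdegree V E v = card (neighbors V E v)"

definition walk_between :: "'a set \<Rightarrow> 'a set set \<Rightarrow> 'a \<Rightarrow> 'a list \<Rightarrow> 'a \<Rightarrow> bool" where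
  "walk_between V E u p v \<longleftrightarrow>
     p \<noteq> [] \<and> set p \<subseteq> V \<and> successively (\<lambda>x y. {x, y} \<in> E) p \<and> hd p = u \<and> last p = v"

definition graph_cycle :: "'a set \<Rightarrow> 'a set set \<Rightarrow> 'a list \<Rightarrow> bool" where
  "graph_cycle V E p \<longleftrightarrow>
     3 \<le> length p \<and> distinct p \<and> set p \<subseteq> V \<and>
     successively (\<lambda>x y. {x, y} \<in> E) p \<and> {last p, hd p} \<in> E"

definition connected_graph :: "'a set \<Rightarrow> 'a set set \<Rightarrow> bool" where
  "connected_graph V E \<longleftrightarrow> V \<noteq> {} \<and> (\<forall>u\<in>V. \<forall>v\<in>V. \<exists>p. walk_between V E u p v)"

definition tree_graph :: "'a set \<Rightarrow> 'a set set \<Rightarrow> bool" where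
  "tree_graph V E \<longleftrightarrow> simple_graph V E \<and> connected_graph V E \<and> (\<nexists>p. graph_cycle V E p)"

definition reduced_graph :: "'a set \<Rightarrow> 'a set set \<Rightarrow> bool" where
  "reduced_graph V E \<longleftrightarrow> (\<forall>u\<in>V. \<forall>v\<in>V. u \<noteq> v \<longrightarrow> neighbors V E u \<noteq> neighbors V E v)"

text \<open>
  A walk visiting \<open>length p\<close> vertices has \<open>length p - 1\<close> edges. The distance between vertices in
  different components is \<open>\<infinity>\<close>, the infimum of the empty set.
\<close>

definition vertex_dist :: "'a set \<Rightarrow> 'a set set \<Rightarrow> 'a \<Rightarrow> 'a \<Rightarrow> enat" where
  "vertex_dist V E u v = (INF p\<in>{p. walk_between V E u p v}. enat (length p - 1))"

definition edge_dist :: "'a set \<Rightarrow> 'a set set \<Rightarrow> 'a set \<Rightarrow> 'a set \<Rightarrow> enat" where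
  "edge_dist V E e f = (INF u\<in>e. INF v\<in>f. vertex_dist V E u v)"

definition covers :: "'a set \<Rightarrow> 'a set set \<Rightarrow> 'a set \<Rightarrow> 'a set \<Rightarrow> bool" where
  "covers V E e f \<longleftrightarrow> edge_dist V E e f \<le> 1"

definition induced_matching :: "'a set set \<Rightarrow> 'a set set \<Rightarrow> bool" where
  "induced_matching E M \<longleftrightarrow>
     M \<subseteq> E \<and>
     (\<forall>e\<in>M. \<forall>f\<in>M. e \<noteq> f \<longrightarrow> e \<inter> f = {} \<and> \<not> (\<exists>u\<in>e. \<exists>v\<in>f. {u, v} \<in> E))"

definition maximal_induced_matching :: "'a set set \<Rightarrow> 'a set set \<Rightarrow> bool" where
  "maximal_induced_matching E M \<longleftrightarrow>
     induced_matching E M \<and> (\<forall>N. induced_matching E N \<and> M \<subseteq> N \<longrightarrow> N = M)"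

definition well_indumatched :: "'a set set \<Rightarrow> bool" where
  "well_indumatched E \<longleftrightarrow>
     (\<forall>M N. maximal_induced_matching E M \<and> maximal_induced_matching E N \<longrightarrow> card M = card N)"

definition good_pendant_edges :: "'a set \<Rightarrow> 'a set set \<Rightarrow> 'a set set" where
  "good_pendant_edges V E =
     {e \<in> E. \<exists>u v. e = {u, v} \<and> u \<noteq> v \<and> vdegree V E u = 1 \<and> vdegree V E v = 2}"

end

theory Submission
  imports Defs
begin

text \<open>
  Induced matchings are the independent sets of the square of the line graph. For a tree, listing
  the edges by decreasing depth is a perfect elimination ordering of that square, and a well-covered
  graph with such an ordering is one in which every vertex has exactly one simplicial vertex in its
  closed neighbourhood, provided that no two simplicial vertices are adjacent: eliminating
  greedily yields as many cliques covering the graph as pairwise independent vertices, so every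
  maximal independent set must meet each of these cliques, which forces each to be the closed
  neighbourhood of one of its vertices. In a reduced tree with at least five vertices the
  simplicial edges are the good pendant edges.
\<close>

section \<open>Well-covered graphs with a perfect elimination ordering\<close>

definition independent_in :: "'b set \<Rightarrow> ('b \<Rightarrow> 'b \<Rightarrow> bool) \<Rightarrow> 'b set \<Rightarrow> bool" where
  "independent_in X R I \<longleftrightarrow> I \<subseteq> X \<and> (\<forall>x\<in>I. \<forall>y\<in>I. x \<noteq> y \<longrightarrow> \<not> R x y)"

lemma independent_inD: "independent_in X R I \<Longrightarrow> x \<in> I \<Longrightarrow> y \<in> I \<Longrightarrow> R x y \<Longrightarrow> x = y"
  unfolding independent_in_def by blast

definition maximal_independent_in :: "'b set \<Rightarrow> ('b \<Rightarrow> 'b \<Rightarrow> bool) \<Rightarrow> 'b set \<Rightarrow> bool" where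
  "maximal_independent_in X R I \<longleftrightarrow>
     independent_in X R I \<and> (\<forall>J. independent_in X R J \<and> I \<subseteq> J \<longrightarrow> J = I)"

definition well_covered :: "'b set \<Rightarrow> ('b \<Rightarrow> 'b \<Rightarrow> bool) \<Rightarrow> bool" where
  "well_covered X R \<longleftrightarrow>
     (\<forall>I J. maximal_independent_in X R I \<and> maximal_independent_in X R J \<longrightarrow> card I = card J)"

text \<open>As \<open>R\<close> is taken to be reflexive, \<open>R s y\<close> describes the closed
  neighbourhood of \<open>s\<close>, and the condition makes that neighbourhood a clique.\<close>

definition simplicial :: "'b set \<Rightarrow> ('b \<Rightarrow> 'b \<Rightarrow> bool) \<Rightarrow> 'b \<Rightarrow> bool" where
  "simplicial X R s \<longleftrightarrow> s \<in> X \<and> (\<forall>y\<in>X. \<forall>z\<in>X. R s y \<longrightarrow> R s z \<longrightarrow> R y z)"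

text \<open>Ties in the ranking are harmless: the condition below is imposed on all elements of
  equal rank as well.\<close>

definition perfect_elimination :: "'b set \<Rightarrow> ('b \<Rightarrow> 'b \<Rightarrow> bool) \<Rightarrow> ('b \<Rightarrow> nat) \<Rightarrow> bool" where
  "perfect_elimination X R f \<longleftrightarrow>
     (\<forall>x\<in>X. \<forall>y\<in>X. \<forall>z\<in>X. f y \<le> f x \<longrightarrow> f z \<le> f x \<longrightarrow> R x y \<longrightarrow> R x z \<longrightarrow> R y z)"

locale reflexive_graph =
  fixes X :: "'b set" and R :: "'b \<Rightarrow> 'b \<Rightarrow> bool"
  assumes finite_vertices: "finite X"
    and R_refl: "x \<in> X \<Longrightarrow> R x x"
    and R_sym: "R x y \<Longrightarrow> R y x"
begin

lemma finite_maximal_independent_in: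
  assumes "maximal_independent_in X R I"
  shows "finite I"
proof -
  have "I \<subseteq> X" using assms unfolding maximal_independent_in_def independent_in_def by blast
  then show ?thesis using finite_vertices by (rule finite_subset)
qed

lemma independent_in_extend:
  assumes "independent_in X R I"
  obtains J where "maximal_independent_in X R J" "I \<subseteq> J"
proof -
  let ?A = "{J. independent_in X R J \<and> I \<subseteq> J}"
  have "finite ?A"
    by (rule finite_subset[of _ "Pow X"]) (auto simp: independent_in_def finite_vertices)
  moreover have "I \<in> ?A" using assms by simp
  ultimately obtain J where "J \<in> ?A" "\<forall>K\<in>?A. J \<subseteq> K \<longrightarrow> J = K"
    using finite_has_maximal[of ?A] by blast
  then have "maximal_independent_in X R J" "I \<subseteq> J"
    unfolding maximal_independent_in_def by auto
  then show thesis by (rule that)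
qed

lemma maximal_independent_in_dominates:
  assumes "maximal_independent_in X R I" "x \<in> X"
  obtains y where "y \<in> I" "R x y"
proof (rule ccontr)
  assume "\<not> thesis"
  then have no: "\<And>y. y \<in> I \<Longrightarrow> \<not> R x y" using that by blast
  then have "\<And>y. y \<in> I \<Longrightarrow> \<not> R y x" using R_sym by blast
  with no have "independent_in X R (insert x I)"
    using assms unfolding maximal_independent_in_def independent_in_def by auto
  then have "x \<in> I"
    using assms(1) unfolding maximal_independent_in_def by blast
  with no R_refl assms(2) show False by blast
qed

text \<open>An element of greatest rank has a clique as closed neighbourhood in \<open>Y\<close>;
  remove that clique and recurse. The map \<open>c\<close> sends each vertex to the element whose
  clique removed it, so its fibres are cliques and are indexed by the independent set
  \<open>I\<close>.\<close>

lemma greedy_clique_cover: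
  assumes "Y \<subseteq> X" "perfect_elimination X R f"
  shows "\<exists>I c. independent_in Y R I \<and> (\<forall>x\<in>Y. c x \<in> I) \<and>
           (\<forall>x\<in>Y. \<forall>y\<in>Y. c x = c y \<longrightarrow> R x y)"
  using assms(1)
proof (induction "card Y" arbitrary: Y rule: less_induct)
  case less
  have finY: "finite Y" using less.prems finite_vertices finite_subset by blast
  show ?case
  proof (cases "Y = {}")
    case True
    then show ?thesis by (auto simp: independent_in_def)
  next
    case False
    have "Max (f ` Y) \<in> f ` Y" using finY False by simp
    then obtain s where s: "s \<in> Y" "f s = Max (f ` Y)" by (metis imageE)
    then have s_max: "\<forall>y\<in>Y. f y \<le> f s" using finY by simp
    let ?Z = "{y \<in> Y. \<not> R s y}"
    have "R s s" using R_refl s(1) less.prems by blast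
    then have "?Z \<subset> Y" using s(1) by blast
    then have smaller: "card ?Z < card Y" using finY psubset_card_mono by blast
    have "?Z \<subseteq> X" using less.prems by blast
    from less.hyps[OF smaller this] obtain I c where Ic: "independent_in ?Z R I" "\<forall>x\<in>?Z. c x \<in> I"
      "\<forall>x\<in>?Z. \<forall>y\<in>?Z. c x = c y \<longrightarrow> R x y"
      by (elim exE conjE)
    let ?c = "\<lambda>x. if R s x then s else c x"
    have sI: "s \<notin> I" using Ic(1) \<open>R s s\<close> unfolding independent_in_def by blast
    \<comment> \<open>The old values of \<open>c\<close> lie in \<open>I\<close>, which omits
      \<open>s\<close>, so the fibre of \<open>?c\<close> over \<open>s\<close> is exactly the newly
      removed clique.\<close>
    have c_ne: "c z \<noteq> s" if "z \<in> Y" "\<not> R s z" for z using that Ic(2) sI by blast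
    have "independent_in Y R (insert s I)"
      using Ic(1) s(1) R_sym unfolding independent_in_def by blast
    moreover have "\<forall>x\<in>Y. ?c x \<in> insert s I" using Ic(2) by auto
    moreover have "R x y" if "x \<in> Y" "y \<in> Y" "?c x = ?c y" for x y
    proof (cases "R s x")
      case True
      then have "R s y" using that(2,3) c_ne[of y] by (cases "R s y") auto
      then show ?thesis
        using True s(1) s_max that(1,2) less.prems assms(2) unfolding perfect_elimination_def by blast
    next
      case False
      then have "\<not> R s y" using that(1,3) c_ne[of x] by auto
      then show ?thesis using False that Ic(3)[rule_format, of x y] by simp
    qed
    ultimately show ?thesis by (intro exI[of _ "insert s I"] exI[of _ ?c]) blast
  qed
qed

text \<open>Some vertex of the cycle ranks at least as high as both its neighbours on the cycle;
  these two are then adjacent and form a chord.\<close>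

lemma perfect_elimination_no_induced_4cycle:
  assumes "perfect_elimination X R f" "a \<in> X" "b \<in> X" "c \<in> X" "d \<in> X"
    and "R a b" "R b c" "R c d" "R d a"
  shows "R a c \<or> R b d"
proof -
  have *: "R q s"
    if "p \<in> X" "q \<in> X" "s \<in> X" "f q \<le> f p" "f s \<le> f p" "R p q" "R p s" for p q s
    using assms(1) that unfolding perfect_elimination_def by blast
  have sym: "R b a" "R c b" "R d c" "R a d" using assms R_sym by blast+
  consider "f b \<le> f a \<and> f d \<le> f a" | "f a \<le> f b \<and> f c \<le> f b"
    | "f b \<le> f c \<and> f d \<le> f c" | "f a \<le> f d \<and> f c \<le> f d"
    by linarith
  then show ?thesis
  proof cases
    case 1 then show ?thesis using *[of a b d] assms sym by blast
  next
    case 2 then show ?thesis using *[of b a c] assms sym by blast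
  next
    case 3 then show ?thesis using *[of c b d] assms sym by blast
  next
    case 4 then show ?thesis using *[of d a c] assms sym by blast
  qed
qed

text \<open>Among the independent sets outside the clique \<open>Q\<close>, one dominating as much of \<open>Q\<close> as possible
  dominates all of \<open>Q\<close>: for adjacent \<open>y\<close>, \<open>z\<close> outside \<open>Q\<close> the traces of their neighbourhoods on \<open>Q\<close>
  are nested, since otherwise there is an induced 4-cycle, so that an element reaching a new
  vertex of \<open>Q\<close> can replace all its neighbours in the set.\<close>

lemma independent_set_dominating_clique:
  assumes pe: "perfect_elimination X R f"
    and Q: "Q \<subseteq> X" "\<forall>x\<in>Q. \<forall>y\<in>Q. R x y"
    and out: "\<forall>q\<in>Q. \<exists>y\<in>X - Q. R q y"
  shows "\<exists>I. independent_in (X - Q) R I \<and> (\<forall>q\<in>Q. \<exists>y\<in>I. R q y)"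
proof -
  define D where "D I = {q \<in> Q. \<exists>y\<in>I. R q y}" for I
  have finQ: "finite Q" using Q(1) finite_vertices finite_subset by blast
  have "independent_in (X - Q) R {}" by (simp add: independent_in_def)
  moreover have "\<forall>I. independent_in (X - Q) R I \<longrightarrow> card (D I) < Suc (card Q)"
    using finQ by (auto simp: D_def less_Suc_eq_le intro: card_mono)
  ultimately obtain I where I: "independent_in (X - Q) R I"
      "\<forall>J. independent_in (X - Q) R J \<longrightarrow> card (D J) \<le> card (D I)"
    using ex_has_greatest_nat[of "independent_in (X - Q) R" "{}" "\<lambda>I. card (D I)" "Suc (card Q)"]
    by blast
  have "\<exists>y\<in>I. R q y" if q: "q \<in> Q" for q
  proof (rule ccontr)
    assume nq: "\<not> (\<exists>y\<in>I. R q y)"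
    obtain y where y: "y \<in> X" "y \<notin> Q" "R q y" using out q by blast
    let ?J = "insert y {z \<in> I. \<not> R y z}"
    have "independent_in (X - Q) R ?J"
      using I(1) y R_sym unfolding independent_in_def by blast
    moreover have "D I \<subset> D ?J"
    proof
      show "D I \<subseteq> D ?J"
      proof
        fix p assume "p \<in> D I"
        then obtain z where p: "p \<in> Q" and z: "z \<in> I" "R p z" unfolding D_def by blast
        \<comment> \<open>If \<open>z\<close> is dropped from the set, then \<open>p\<close>,
          \<open>q\<close>, \<open>y\<close>, \<open>z\<close> form a 4-cycle. The chord from
          \<open>q\<close> to \<open>z\<close> is impossible because \<open>I\<close> does not
          dominate \<open>q\<close>, so \<open>y\<close> takes over the domination of
          \<open>p\<close>.\<close>
        have "R p y" if "R y z"
        proof -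
          have "z \<in> X" using z I(1) unfolding independent_in_def by blast
          moreover have "\<not> R q z" using nq z by blast
          ultimately show ?thesis
            using perfect_elimination_no_induced_4cycle[OF pe, of p q y z] p q y z that Q R_sym
            by blast
        qed
        then show "p \<in> D ?J" using p z unfolding D_def by blast
      qed
      show "D I \<noteq> D ?J" using q nq y unfolding D_def by blast
    qed
    moreover have "finite (D ?J)" using finQ unfolding D_def by simp
    ultimately show False using I(2) psubset_card_mono by (metis not_less)
  qed
  with I(1) show ?thesis by blast
qed

text \<open>The map \<open>c\<close> of a greedy cover is injective on independent sets, so a
  maximal independent set, having at least \<open>card I\<close> elements, meets every fibre. Were
  every vertex in the fibre of \<open>x\<close> to have a neighbour outside it, an independent set
  outside the fibre would dominate it, and a maximal extension would miss the fibre. So some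
  \<open>s\<close> in the fibre has no neighbours outside and is simplicial.\<close>

lemma well_covered_near_simplicial:
  assumes wc: "well_covered X R" and pe: "perfect_elimination X R f" and x: "x \<in> X"
  shows "\<exists>s. simplicial X R s \<and> R s x"
proof -
  obtain I c where Ic: "independent_in X R I" "\<forall>x\<in>X. c x \<in> I"
    "\<forall>x\<in>X. \<forall>y\<in>X. c x = c y \<longrightarrow> R x y"
    using greedy_clique_cover[OF order_refl pe] by blast
  have finI: "finite I"
    using Ic(1) finite_vertices finite_subset unfolding independent_in_def by blast
  have inj: "inj_on c J" if "independent_in X R J" for J
    using that Ic(3) unfolding inj_on_def independent_in_def by blast
  have card_max: "card J \<ge> card I" if "maximal_independent_in X R J" for J
  proof -
    obtain K where K: "maximal_independent_in X R K" "I \<subseteq> K"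
      using independent_in_extend[OF Ic(1)] by blast
    then have "finite K" by (intro finite_maximal_independent_in)
    then have "card I \<le> card K" using K(2) card_mono by blast
    also have "card K = card J" using wc K(1) that unfolding well_covered_def by blast
    finally show ?thesis .
  qed
  let ?Q = "{y \<in> X. c y = c x}"
  have clique: "\<forall>y\<in>?Q. \<forall>z\<in>?Q. R y z" using Ic(3) by auto
  have "\<exists>s\<in>?Q. \<forall>y\<in>X - ?Q. \<not> R s y"
  proof (rule ccontr)
    assume "\<not> ?thesis"
    then obtain K where K: "independent_in (X - ?Q) R K" "\<forall>q\<in>?Q. \<exists>y\<in>K. R q y"
      using independent_set_dominating_clique[OF pe _ clique] by auto
    then have "independent_in X R K" unfolding independent_in_def by blast
    then obtain J where J: "maximal_independent_in X R J" "K \<subseteq> J"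
      using independent_in_extend by blast
    then have iJ: "independent_in X R J" unfolding maximal_independent_in_def by blast
    have "q \<notin> ?Q" if q: "q \<in> J" for q
    proof
      assume qQ: "q \<in> ?Q"
      then obtain y where y: "y \<in> K" "R q y" using K(2) by blast
      then have "y \<notin> ?Q" using K(1) unfolding independent_in_def by blast
      then have "y \<noteq> q" using qQ by blast
      then show False using independent_inD[OF iJ q _ y(2)] y(1) J(2) by auto
    qed
    moreover have "J \<subseteq> X" using iJ unfolding independent_in_def by blast
    ultimately have "c ` J \<subseteq> I - {c x}" using Ic(2) by auto
    moreover have "c x \<in> I" using Ic(2) x by blast
    ultimately have "c ` J \<subset> I" by blast
    then have "card (c ` J) < card I" using finI psubset_card_mono by blast
    then show False using card_max[OF J(1)] card_image[OF inj[OF iJ]] by simp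
  qed
  then obtain s where s: "s \<in> ?Q" "\<forall>y\<in>X - ?Q. \<not> R s y" by blast
  then have "simplicial X R s" using clique unfolding simplicial_def by blast
  moreover have "R s x" using s(1) clique x by blast
  ultimately show ?thesis by blast
qed

text \<open>Exchanging \<open>x\<close> for \<open>s\<close> and \<open>t\<close> in a maximal independent set containing \<open>x\<close> would give an
  independent set that is larger.\<close>

lemma well_covered_simplicial_unique:
  assumes wc: "well_covered X R" and x: "x \<in> X"
    and s: "simplicial X R s" "R s x" and t: "simplicial X R t" "R t x"
  shows "R s t"
proof (rule ccontr)
  assume nst: "\<not> R s t"
  have "independent_in X R {x}" using x by (simp add: independent_in_def)
  then obtain I where I: "maximal_independent_in X R I" "x \<in> I"
    using independent_in_extend by blast
  then have iI: "independent_in X R I" unfolding maximal_independent_in_def by blast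
  have finI: "finite I" using I(1) by (rule finite_maximal_independent_in)
  have sX: "s \<in> X" and tX: "t \<in> X" using s(1) t(1) unfolding simplicial_def by blast+
  \<comment> \<open>A neighbour of \<open>u\<close> in \<open>I\<close> would be adjacent to
    \<open>x\<close> as well, because both lie in the clique around \<open>u\<close>.\<close>
  have far: "\<not> R u y" if "simplicial X R u" "R u x" "y \<in> I - {x}" for u y
  proof
    assume "R u y"
    moreover have "y \<in> X" using that(3) iI unfolding independent_in_def by blast
    ultimately have "R x y" using that(1,2) x unfolding simplicial_def by blast
    then show False using independent_inD[OF iI I(2)] that(3) by blast
  qed
  have fars: "\<not> R s y" and fart: "\<not> R t y" if "y \<in> I - {x}" for y
    using far[OF s that] far[OF t that] .
  have notin: "s \<notin> I - {x}" "t \<notin> I - {x}" "s \<noteq> t"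
    using fars fart R_refl sX tX nst by auto
  let ?J = "insert s (insert t (I - {x}))"
  have "independent_in X R ?J"
    using iI sX tX nst fars fart R_sym unfolding independent_in_def by blast
  then obtain K where K: "maximal_independent_in X R K" "?J \<subseteq> K"
    using independent_in_extend by blast
  then have "finite K" by (intro finite_maximal_independent_in)
  then have "card ?J \<le> card K" using K(2) card_mono by blast
  moreover have "card ?J = Suc (card I)"
    using notin finI card_Suc_Diff1[OF finI I(2)] by (simp del: card_Diff_insert)
  moreover have "card K = card I" using wc K(1) I(1) unfolding well_covered_def by blast
  ultimately show False by simp
qed

text \<open>Every maximal independent set meets the closed neighbourhood of each \<open>m \<in> S\<close> exactly once.\<close>

lemma well_covered_if_simplicial_partition:
  assumes S: "\<forall>m\<in>S. simplicial X R m" and part: "\<forall>x\<in>X. \<exists>!m. m \<in> S \<and> R m x"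
  shows "well_covered X R"
proof -
  have "card I = card S" if I: "maximal_independent_in X R I" for I
  proof -
    \<comment> \<open>On \<open>I\<close> this map is a bijection onto \<open>S\<close>: injective
      because closed neighbourhoods of simplicial vertices are cliques, surjective because
      \<open>I\<close> is dominating.\<close>
    define g where "g x = (THE m. m \<in> S \<and> R m x)" for x
    have g: "g x \<in> S" "R (g x) x" if "x \<in> X" for x
      using theI'[OF bspec[OF part that]] unfolding g_def by auto
    have g_eq: "g x = m" if "x \<in> X" "m \<in> S" "R m x" for x m
      using g that part by blast
    have iI: "independent_in X R I" using I unfolding maximal_independent_in_def by blast
    then have IX: "I \<subseteq> X" unfolding independent_in_def by blast
    have "inj_on g I"
    proof (rule inj_onI)
      fix x y assume xy: "x \<in> I" "y \<in> I" "g x = g y"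
      then have "R x y"
        using g[of x] g[of y] S IX unfolding simplicial_def by (metis subsetD)
      then show "x = y" using xy iI unfolding independent_in_def by blast
    qed
    moreover have "g ` I = S"
    proof
      show "g ` I \<subseteq> S" using g IX by blast
      show "S \<subseteq> g ` I"
      proof
        fix m assume m: "m \<in> S"
        then have "m \<in> X" using S unfolding simplicial_def by blast
        then obtain y where "y \<in> I" "R m y"
          using maximal_independent_in_dominates[OF I] by blast
        then show "m \<in> g ` I" using g_eq[of y m] m IX by blast
      qed
    qed
    ultimately show ?thesis using card_image by metis
  qed
  then show ?thesis unfolding well_covered_def by simp
qed

text \<open>Well-coveredness makes any two simplicial vertices near the same \<open>x\<close>
  adjacent; the second assumption turns this into equality, hence into uniqueness.\<close>

theorem well_covered_iff_simplicial_partition: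
  assumes "perfect_elimination X R f"
    and "\<And>s t. simplicial X R s \<Longrightarrow> simplicial X R t \<Longrightarrow> R s t \<Longrightarrow> s = t"
  shows "well_covered X R \<longleftrightarrow> (\<forall>x\<in>X. \<exists>!m. simplicial X R m \<and> R m x)"
proof
  assume "well_covered X R"
  then show "\<forall>x\<in>X. \<exists>!m. simplicial X R m \<and> R m x"
    using well_covered_near_simplicial[OF _ assms(1)] well_covered_simplicial_unique assms(2)
    by metis
next
  assume "\<forall>x\<in>X. \<exists>!m. simplicial X R m \<and> R m x"
  then show "well_covered X R"
    using well_covered_if_simplicial_partition[of "{m. simplicial X R m}"] by simp
qed

end

section \<open>Edges at distance at most one\<close>

text \<open>Adjacency or equality in the square of the line graph; its independent sets are the
  induced matchings.\<close>

definition near :: "'a set set \<Rightarrow> 'a set \<Rightarrow> 'a set \<Rightarrow> bool" where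
  "near E e f \<longleftrightarrow> (\<exists>u\<in>e. \<exists>v\<in>f. u = v \<or> {u, v} \<in> E)"

lemma induced_matching_iff_independent: "induced_matching E = independent_in E (near E)"
  unfolding induced_matching_def independent_in_def near_def by (intro ext) blast

lemma well_indumatched_iff_well_covered: "well_indumatched E \<longleftrightarrow> well_covered E (near E)"
  unfolding well_indumatched_def well_covered_def maximal_induced_matching_def
    maximal_independent_in_def induced_matching_iff_independent ..

lemma simple_graph_edge:
  assumes "simple_graph V E" "{u, v} \<in> E"
  shows "u \<in> V" "v \<in> V" "u \<noteq> v"
  using assms unfolding simple_graph_def by (auto simp: card_insert_if split: if_splits)

lemma simple_graph_edgeE:
  assumes "simple_graph V E" "e \<in> E"
  obtains u v where "e = {u, v}" "{u, v} \<in> E"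
  using assms unfolding simple_graph_def by (metis card_2_iff)

lemma finite_edges:
  assumes "simple_graph V E"
  shows "finite E"
  using assms unfolding simple_graph_def by (intro finite_subset[of E "Pow V"]) auto

lemma reflexive_graph_near:
  assumes "simple_graph V E"
  shows "reflexive_graph E (near E)"
proof
  show "finite E" using assms by (rule finite_edges)
  show "near E e e" if "e \<in> E" for e
    using simple_graph_edgeE[OF assms that] unfolding near_def by blast
  show "near E f e" if "near E e f" for e f
    using that unfolding near_def by (metis insert_commute)
qed

lemma short_walk_iff:
  assumes "simple_graph V E"
  shows "(\<exists>p. walk_between V E u p v \<and> length p - 1 < 2) \<longleftrightarrow> (u = v \<and> u \<in> V) \<or> {u, v} \<in> E"
    (is "?L \<longleftrightarrow> ?R")
proof
  assume ?L
  then obtain p where p: "walk_between V E u p v" "length p - 1 < 2" by blast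
  then have "p \<noteq> []" "length p \<le> 2" unfolding walk_between_def by auto
  then consider a where "p = [a]" | a b where "p = [a, b]"
    by (cases p; cases "tl p") auto
  then show ?R using p unfolding walk_between_def by cases auto
next
  assume ?R
  then show ?L
  proof
    assume "u = v \<and> u \<in> V"
    then have "walk_between V E u [u] v" unfolding walk_between_def by auto
    then show ?L by (intro exI[of _ "[u]"]) simp
  next
    assume "{u, v} \<in> E"
    then have "walk_between V E u [u, v] v"
      using simple_graph_edge[OF assms] unfolding walk_between_def by simp
    then show ?L by (intro exI[of _ "[u, v]"]) simp
  qed
qed

lemma covers_iff_near:
  assumes G: "simple_graph V E" and e: "e \<in> E"
  shows "covers V E e f \<longleftrightarrow> near E e f"
proof -
  \<comment> \<open>The strict form is used because an infimum is strictly below a bound iff some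
    member is, which replaces distances by witnessing walks.\<close>
  have le1: "x \<le> 1 \<longleftrightarrow> x < 2" for x :: enat
    by (cases x) (auto simp: one_enat_def numeral_eq_enat)
  have "vertex_dist V E u v < 2 \<longleftrightarrow> (u = v \<and> u \<in> V) \<or> {u, v} \<in> E" for u v
    unfolding vertex_dist_def INF_less_iff short_walk_iff[OF G, symmetric]
    by (auto simp: numeral_eq_enat)
  then have "covers V E e f \<longleftrightarrow> (\<exists>u\<in>e. \<exists>v\<in>f. (u = v \<and> u \<in> V) \<or> {u, v} \<in> E)"
    unfolding covers_def edge_dist_def le1 INF_less_iff by simp
  moreover have "e \<subseteq> V" using G e unfolding simple_graph_def by blast
  ultimately show ?thesis unfolding near_def by blast
qed

section \<open>Forests\<close>

text \<open>The first vertex of a longest path works: a neighbour off the path would extend it, and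
  one beyond the second vertex would close a cycle.\<close>

lemma acyclic_graph_has_leaf:
  assumes G: "simple_graph V E" and ac: "\<nexists>p. graph_cycle V E p" and ne: "V \<noteq> {}"
  shows "\<exists>v\<in>V. \<forall>u w. {v, u} \<in> E \<longrightarrow> {v, w} \<in> E \<longrightarrow> u = w"
proof -
  let ?P = "\<lambda>p. p \<noteq> [] \<and> distinct p \<and> set p \<subseteq> V \<and> successively (\<lambda>x y. {x, y} \<in> E) p"
  have finV: "finite V" using G unfolding simple_graph_def by blast
  obtain v0 where "v0 \<in> V" using ne by blast
  then have "?P [v0]" by simp
  moreover have "\<forall>p. ?P p \<longrightarrow> length p < Suc (card V)"
    using finV by (metis card_mono distinct_card less_Suc_eq_le)
  ultimately obtain p where p: "?P p" and longest: "\<forall>q. ?P q \<longrightarrow> length q \<le> length p"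
    using ex_has_greatest_nat[of ?P "[v0]" length "Suc (card V)"] by blast
  obtain v q where vq: "p = v # q" using p by (cases p) auto
  \<comment> \<open>For a one-vertex path \<open>hd q\<close> is unspecified; this is harmless,
    since only the coincidence of all neighbours of \<open>v\<close> is used.\<close>
  have nbr: "x = hd q" if x: "{v, x} \<in> E" for x
  proof (rule ccontr)
    assume xh: "x \<noteq> hd q"
    note xV = simple_graph_edge[OF G x]
    have "x \<in> set p"
    proof (rule ccontr)
      assume "x \<notin> set p"
      then have "?P (x # p)" using p xV x vq by (auto simp: insert_commute)
      then show False using longest by fastforce
    qed
    then have "x \<in> set q" using vq xV by auto
    then obtain q1 q2 where q: "q = q1 @ x # q2" by (meson split_list)
    then have q1: "q1 \<noteq> []" using xh by auto
    have path: "successively (\<lambda>x y. {x, y} \<in> E) (v # q1 @ [x])"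
    proof -
      have "p = (v # q1 @ [x]) @ q2" using vq q by simp
      then show ?thesis using p successively_append_iff by metis
    qed
    have "graph_cycle V E (v # q1 @ [x])"
      unfolding graph_cycle_def
      using p vq q q1 x path by (auto simp: insert_commute Suc_le_eq)
    then show False using ac by blast
  qed
  have "v \<in> V" using p vq by simp
  then show ?thesis using nbr by blast
qed

text \<open>The function \<open>d\<close> plays the role of the level in a rooted forest, and the
  second clause says that parents are unique. It is built by removing a vertex with at most one
  neighbour and putting it back one level below that neighbour.\<close>

lemma acyclic_graph_depth:
  assumes "simple_graph V E" "\<nexists>p. graph_cycle V E p"
  shows "\<exists>d :: 'a \<Rightarrow> nat. (\<forall>u v. {u, v} \<in> E \<longrightarrow> d u = Suc (d v) \<or> d v = Suc (d u)) \<and>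
     (\<forall>v u w. {v, u} \<in> E \<longrightarrow> {v, w} \<in> E \<longrightarrow> d u < d v \<longrightarrow> d w < d v \<longrightarrow> u = w)"
  using assms
proof (induction "card V" arbitrary: V E rule: less_induct)
  case less
  note G = less.prems(1)
  have finV: "finite V" using G unfolding simple_graph_def by blast
  show ?case
  proof (cases "V = {}")
    case True
    then have "\<And>u v. {u, v} \<notin> E" using simple_graph_edge[OF G] by blast
    then show ?thesis by blast
  next
    case False
    then obtain v where v: "v \<in> V" "\<And>u w. {v, u} \<in> E \<Longrightarrow> {v, w} \<in> E \<Longrightarrow> u = w"
      using acyclic_graph_has_leaf[OF less.prems] by blast
    let ?V = "V - {v}" and ?E = "{e \<in> E. v \<notin> e}"
    have smaller: "card ?V < card V" using finV v(1) by (meson card_Diff1_less)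
    have simple': "simple_graph ?V ?E" using G unfolding simple_graph_def by auto
    have acyclic': "\<nexists>p. graph_cycle ?V ?E p"
    proof
      assume "\<exists>p. graph_cycle ?V ?E p"
      then obtain p where p: "graph_cycle ?V ?E p" by blast
      then have "successively (\<lambda>x y. {x, y} \<in> E) p"
        unfolding graph_cycle_def by (auto elim: successively_mono)
      then have "graph_cycle V E p" using p unfolding graph_cycle_def by auto
      then show False using less.prems(2) by blast
    qed
    from less.hyps[OF smaller simple' acyclic'] obtain d :: "'a \<Rightarrow> nat"
      where d: "\<forall>a b. {a, b} \<in> ?E \<longrightarrow> d a = Suc (d b) \<or> d b = Suc (d a)"
        "\<forall>a b c. {a, b} \<in> ?E \<longrightarrow> {a, c} \<in> ?E \<longrightarrow> d b < d a \<longrightarrow> d c < d a \<longrightarrow> b = c"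
      by (elim exE conjE)
    note d1 = d(1)[rule_format] and d2 = d(2)[rule_format]
    \<comment> \<open>If \<open>v\<close> is isolated, \<open>w\<close> is arbitrary; the level of
      \<open>v\<close> then enters no condition.\<close>
    define w where "w = (SOME w. {v, w} \<in> E)"
    have w: "x = w" if "{v, x} \<in> E" for x
      using v(2)[OF that] someI[of "\<lambda>w. {v, w} \<in> E", OF that] unfolding w_def by blast
    have w': "x = w" if "{x, v} \<in> E" for x using w that by (metis insert_commute)
    have loop: "{x, x} \<notin> E" for x using simple_graph_edge[OF G] by blast
    let ?d = "d(v := Suc (d w))"
    have "?d a = Suc (?d b) \<or> ?d b = Suc (?d a)" if ab: "{a, b} \<in> E" for a b
      using ab w[of b] w'[of a] d1[of a b] loop[of v] by (cases "a = v"; cases "b = v") auto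
    moreover have "b = c"
      if ab: "{a, b} \<in> E" and ac: "{a, c} \<in> E" and less: "?d b < ?d a" "?d c < ?d a" for a b c
    proof (cases "a = v")
      case True
      then show ?thesis using ab ac v(2) by blast
    next
      case False
      \<comment> \<open>The only neighbour of \<open>v\<close> is less deep than \<open>v\<close>,
        so \<open>v\<close> is nobody's parent.\<close>
      have "b \<noteq> v" "c \<noteq> v" using False ab ac less w'[of a] by auto
      then show ?thesis using False ab ac less d2[of a b c] by auto
    qed
    ultimately show ?thesis by blast
  qed
qed

text \<open>Edges are eliminated deepest first. An edge near \<open>{u, v}\<close> that is not deeper, where \<open>v\<close> is the
  parent of \<open>u\<close>, contains \<open>v\<close> or the parent of \<open>v\<close>.\<close>

lemma acyclic_graph_perfect_elimination:
  assumes G: "simple_graph V E" and ac: "\<nexists>p. graph_cycle V E p"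
  shows "\<exists>f. perfect_elimination E (near E) f"
proof -
  obtain d :: "'a \<Rightarrow> nat"
    where d1: "\<And>a b. {a, b} \<in> E \<Longrightarrow> d a = Suc (d b) \<or> d b = Suc (d a)"
    and d2: "\<And>a b c. {a, b} \<in> E \<Longrightarrow> {a, c} \<in> E \<Longrightarrow> d b < d a \<Longrightarrow> d c < d a \<Longrightarrow> b = c"
    using acyclic_graph_depth[OF assms] by blast
  define D where "D e = Max (d ` e)" for e
  have edge: "\<exists>u v. e = {u, v} \<and> {u, v} \<in> E \<and> d u = Suc (d v) \<and> D e = d u" if e: "e \<in> E" for e
  proof -
    obtain a b where ab: "e = {a, b}" "{a, b} \<in> E" using simple_graph_edgeE[OF G e] .
    then consider "d a = Suc (d b)" | "d b = Suc (d a)" using d1 by blast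
    then show ?thesis
    proof cases
      case 1
      then show ?thesis using ab by (intro exI[of _ a] exI[of _ b]) (simp add: D_def)
    next
      case 2
      then show ?thesis
        using ab by (intro exI[of _ b] exI[of _ a]) (simp add: D_def insert_commute)
    qed
  qed
  have "near E y z"
    if x: "x \<in> E" and y: "y \<in> E" "D y \<le> D x" "near E x y"
      and z: "z \<in> E" "D z \<le> D x" "near E x z" for x y z
  proof -
    obtain u v where uv: "x = {u, v}" "{u, v} \<in> E" "d u = Suc (d v)" "D x = d u"
      using edge[OF x] by blast
    have touch: "v \<in> f \<or> (\<exists>w\<in>f. {v, w} \<in> E \<and> d w < d v)"
      if f: "f \<in> E" "D f \<le> D x" "near E x f" for f
    proof -
      obtain a b where ab: "f = {a, b}" "{a, b} \<in> E" "d a = Suc (d b)" "D f = d a"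
        using edge[OF f(1)] by blast
      have le: "d a \<le> d u" using f(2) ab uv by simp
      \<comment> \<open>No endpoint of \<open>f\<close> is deeper than \<open>u\<close>, so
        \<open>q\<close> must be the deeper endpoint \<open>a\<close>; its unique parent
        \<open>b\<close> is then \<open>v\<close>.\<close>
      have parent: "v \<in> f" if "q \<in> f" "{q, v} \<in> E" "d q = d u" for q
      proof -
        have "q = a" using that ab le by auto
        then show ?thesis using d2[of a b v] ab that uv by auto
      qed
      obtain p q where "p \<in> {u, v}" and q: "q \<in> f" and pq: "p = q \<or> {p, q} \<in> E"
        using f(3) uv(1) unfolding near_def by blast
      then consider "p = u" | "p = v" by blast
      then show ?thesis
      proof cases
        case 1
        have le': "d q \<le> d u" using q ab le by auto
        show ?thesis
        proof (cases "p = q")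
          case True
          then show ?thesis using 1 q parent[of u] uv(2) by blast
        next
          case False
          then have uq: "{u, q} \<in> E" using 1 pq by simp
          then have "d q < d u" using d1[OF uq] le' by linarith
          then have "q = v" using d2[OF uq uv(2)] uv(3) by simp
          then show ?thesis using q by simp
        qed
      next
        case 2
        show ?thesis
        proof (cases "p = q")
          case True
          then show ?thesis using 2 q by blast
        next
          case False
          then have vq: "{v, q} \<in> E" using 2 pq by simp
          then have "{q, v} \<in> E" by (simp add: insert_commute)
          then show ?thesis using d1[OF vq] q vq parent[of q] uv(3) by (metis lessI)
        qed
      qed
    qed
    have sym: "{w, v} \<in> E" if "{v, w} \<in> E" for w using that by (simp add: insert_commute)
    \<comment> \<open>Both edges contain \<open>v\<close> or its parent, and that parent is unique,
      so they share a vertex or are joined by the edge from \<open>v\<close> to its parent.\<close>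
    show ?thesis
      using touch[OF y] touch[OF z] sym d2[of v] unfolding near_def by metis
  qed
  then have "perfect_elimination E (near E) D" unfolding perfect_elimination_def by blast
  then show ?thesis by blast
qed

section \<open>Simplicial edges of reduced trees\<close>

locale large_reduced_tree =
  fixes V :: "'a set" and E :: "'a set set"
  assumes tree: "tree_graph V E" and reduced: "reduced_graph V E" and large: "card V \<ge> 5"
begin

lemma simple: "simple_graph V E" and acyclic: "\<nexists>p. graph_cycle V E p"
  and connected: "connected_graph V E"
  using tree unfolding tree_graph_def by auto

lemmas edge_ends = simple_graph_edge[OF simple]

lemma edge_commute: "{u, v} \<in> E \<Longrightarrow> {v, u} \<in> E"
  by (simp add: insert_commute)

lemma neighbors_eq: "neighbors V E v = {u. {v, u} \<in> E}"
  unfolding neighbors_def using edge_ends by blast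

section \<open>Closed walks of length three to six\<close>

lemma no_3cycle: "{a, b} \<in> E \<Longrightarrow> {b, c} \<in> E \<Longrightarrow> {c, a} \<in> E \<Longrightarrow> False"
proof -
  assume h: "{a, b} \<in> E" "{b, c} \<in> E" "{c, a} \<in> E"
  have "graph_cycle V E [a, b, c]"
    unfolding graph_cycle_def using h edge_ends[OF h(1)] edge_ends[OF h(2)] edge_ends[OF h(3)]
    by auto
  then show False using acyclic by blast
qed

lemma no_4cycle:
  assumes h: "{a, b} \<in> E" "{b, c} \<in> E" "{c, d} \<in> E" "{d, a} \<in> E" and "a \<noteq> c" "b \<noteq> d"
  shows False
proof -
  have "graph_cycle V E [a, b, c, d]"
    unfolding graph_cycle_def using assms edge_ends[OF h(1)] edge_ends[OF h(2)]
      edge_ends[OF h(3)] edge_ends[OF h(4)] by auto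
  then show False using acyclic by blast
qed

text \<open>Identifying two vertices two steps apart would leave a triangle, so distinctness is
  automatic.\<close>

lemma no_5cycle:
  assumes h: "{a, b} \<in> E" "{b, c} \<in> E" "{c, d} \<in> E" "{d, e} \<in> E" "{e, a} \<in> E"
  shows False
proof -
  have "a \<noteq> c" "b \<noteq> d" "c \<noteq> e" "d \<noteq> a" "e \<noteq> b" using h no_3cycle by blast+
  then have "graph_cycle V E [a, b, c, d, e]"
    unfolding graph_cycle_def using h edge_ends[OF h(1)] edge_ends[OF h(2)]
      edge_ends[OF h(3)] edge_ends[OF h(4)] edge_ends[OF h(5)] by auto
  then show False using acyclic by blast
qed

text \<open>Identifying opposite vertices would split the walk into two triangles, so only vertices
  two steps apart have to be assumed distinct.\<close>

lemma no_6cycle: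
  assumes h: "{a, b} \<in> E" "{b, c} \<in> E" "{c, d} \<in> E" "{d, e} \<in> E" "{e, f} \<in> E" "{f, a} \<in> E"
    and "a \<noteq> c" "b \<noteq> d" "c \<noteq> e" "d \<noteq> f" "e \<noteq> a" "f \<noteq> b"
  shows False
proof -
  have "a \<noteq> d" "b \<noteq> e" "c \<noteq> f" using h no_3cycle by blast+
  then have "graph_cycle V E [a, b, c, d, e, f]"
    unfolding graph_cycle_def using assms edge_ends[OF h(1)] edge_ends[OF h(2)]
      edge_ends[OF h(3)] edge_ends[OF h(4)] edge_ends[OF h(5)] edge_ends[OF h(6)] by auto
  then show False using acyclic by blast
qed

text \<open>Reducedness enters here: two leaves attached to \<open>y\<close> have the same
  neighbourhood.\<close>

lemma leaf_unique:
  assumes "{y, b} \<in> E" "{y, c} \<in> E" "\<forall>z. {b, z} \<in> E \<longrightarrow> z = y" "\<forall>z. {c, z} \<in> E \<longrightarrow> z = y"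
  shows "b = c"
proof -
  have "neighbors V E b = {y}" "neighbors V E c = {y}"
    unfolding neighbors_eq using assms edge_commute by blast+
  then show ?thesis
    using reduced edge_ends[OF assms(1)] edge_ends[OF assms(2)] unfolding reduced_graph_def by metis
qed

text \<open>Connectedness and the bound of five vertices enter here: a set closed under adjacency
  that meets \<open>V\<close> contains all of \<open>V\<close>.\<close>

lemma no_small_closed_set:
  assumes "x \<in> V" "x \<in> S" "\<And>u v. u \<in> S \<Longrightarrow> {u, v} \<in> E \<Longrightarrow> v \<in> S" "finite S" "card S \<le> 4"
  shows False
proof -
  have "last p \<in> S" if "successively (\<lambda>x y. {x, y} \<in> E) p" "p \<noteq> []" "hd p \<in> S" for p
    using that
  proof (induction p rule: induct_list012)
    case (3 a b p)
    then show ?case using assms(3)[of a b] by auto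
  qed auto
  then have "V \<subseteq> S"
    using connected assms(1,2) unfolding connected_graph_def walk_between_def by (metis subsetI)
  then have "card V \<le> card S" using assms(4) card_mono by blast
  then show False using large assms(5) by linarith
qed

section \<open>Good pendant edges are simplicial and pairwise not near\<close>

lemma good_pendant_edgeE:
  assumes "m \<in> good_pendant_edges V E"
  obtains u v w where "m = {u, v}" "{u, v} \<in> E" "{v, w} \<in> E" "u \<noteq> w"
    "\<And>z. {u, z} \<in> E \<Longrightarrow> z = v" "\<And>z. {v, z} \<in> E \<Longrightarrow> z = u \<or> z = w"
proof -
  obtain u v where uv: "m = {u, v}" "{u, v} \<in> E" "card {z. {u, z} \<in> E} = 1"
    "card {z. {v, z} \<in> E} = 2"
    using assms unfolding good_pendant_edges_def vdegree_def neighbors_eq by auto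
  obtain v' where "{z. {u, z} \<in> E} = {v'}" using uv(3) card_1_singletonE by blast
  then have "{u, z} \<in> E \<longleftrightarrow> z = v'" for z by (simp add: set_eq_iff)
  then have u: "z = v" if "{u, z} \<in> E" for z using that uv(2) by simp
  obtain a b where "{z. {v, z} \<in> E} = {a, b}" and ab: "a \<noteq> b" using uv(4) card_2_iff by metis
  then have v: "{v, z} \<in> E \<longleftrightarrow> z = a \<or> z = b" for z by (simp add: set_eq_iff)
  then have "u = a \<or> u = b" using edge_commute[OF uv(2)] by simp
  then show thesis
  proof
    assume "u = a"
    then show thesis using that[OF uv(1,2), of b] u v ab by simp
  next
    assume "u = b"
    then show thesis using that[OF uv(1,2), of a] u v ab by auto
  qed
qed

lemma good_pendant_edgeI:
  assumes "{u, v} \<in> E" "{v, w} \<in> E" "u \<noteq> w"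
    "\<And>z. {u, z} \<in> E \<Longrightarrow> z = v" "\<And>z. {v, z} \<in> E \<Longrightarrow> z = u \<or> z = w"
  shows "{u, v} \<in> good_pendant_edges V E"
proof -
  have "{z. {u, z} \<in> E} = {v}" "{z. {v, z} \<in> E} = {u, w}"
    using assms edge_commute by blast+
  then have "vdegree V E u = 1" "vdegree V E v = 2"
    unfolding vdegree_def neighbors_eq using assms(3) by simp_all
  then show ?thesis
    unfolding good_pendant_edges_def using assms(1) edge_ends(3)[OF assms(1)] by blast
qed

text \<open>With \<open>w\<close> the other neighbour of \<open>v\<close>, every edge near
  \<open>m\<close> is \<open>m\<close> itself or contains \<open>w\<close>; any two such edges are
  near through \<open>w\<close> or through the edge from \<open>v\<close> to
  \<open>w\<close>.\<close>

lemma good_pendant_edge_simplicial: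
  assumes "m \<in> good_pendant_edges V E"
  shows "simplicial E (near E) m"
proof -
  obtain u v w where m: "m = {u, v}" "{u, v} \<in> E" "{v, w} \<in> E" "u \<noteq> w"
    and u: "\<And>z. {u, z} \<in> E \<Longrightarrow> z = v" and v: "\<And>z. {v, z} \<in> E \<Longrightarrow> z = u \<or> z = w"
    using good_pendant_edgeE[OF assms] by blast
  have touch: "f = m \<or> w \<in> f" if f: "f \<in> E" "near E m f" for f
  proof -
    obtain q where q: "q \<in> f" "q = u \<or> q = v \<or> q = w"
      using f(2) m(1) u v unfolding near_def by blast
    obtain r where r: "f = {q, r}" "{q, r} \<in> E"
      using simple_graph_edgeE[OF simple f(1)] q(1)
      by (metis edge_commute insert_commute insertE singletonD)
    consider "q = u" "r = v" | "q = v" "r = u" | "w \<in> f"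
      using q r u[of r] v[of r] by blast
    then show ?thesis by cases (simp_all add: r(1) m(1) insert_commute)
  qed
  have pairwise: "near E y z" if "y = m \<or> w \<in> y" "z = m \<or> w \<in> z" for y z
    using that m(1) m(3) edge_commute[OF m(3)] unfolding near_def by blast
  show ?thesis
    unfolding simplicial_def
  proof (intro conjI ballI impI)
    show "m \<in> E" using m(1,2) by simp
    show "near E y z" if "y \<in> E" "z \<in> E" "near E m y" "near E m z" for y z
      using pairwise[OF touch touch] that by simp
  qed
qed

text \<open>Two distinct such edges that are near each other share their degree-two vertex or have
  these vertices joined. The degrees then leave room for no further vertices, so the tree would be a
  path on three or four vertices.\<close>

lemma near_good_pendant_edges_eq:
  assumes "m \<in> good_pendant_edges V E" "m' \<in> good_pendant_edges V E" "near E m m'"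
  shows "m = m'"
proof (rule ccontr)
  assume ne: "m \<noteq> m'"
  obtain u v w where m: "m = {u, v}" "{u, v} \<in> E" "{v, w} \<in> E" "u \<noteq> w"
    and u: "\<And>z. {u, z} \<in> E \<Longrightarrow> z = v" and v: "\<And>z. {v, z} \<in> E \<Longrightarrow> z = u \<or> z = w"
    using good_pendant_edgeE[OF assms(1)] by blast
  obtain u' v' w' where m': "m' = {u', v'}" "{u', v'} \<in> E" "{v', w'} \<in> E" "u' \<noteq> w'"
    and u': "\<And>z. {u', z} \<in> E \<Longrightarrow> z = v'" and v': "\<And>z. {v', z} \<in> E \<Longrightarrow> z = u' \<or> z = w'"
    using good_pendant_edgeE[OF assms(2)] by blast
  have vu: "{v, u} \<in> E" and vu': "{v', u'} \<in> E" using m m' edge_commute by blast+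
  have "u \<noteq> v'" using u vu' m'(3,4) by blast
  moreover have "v \<noteq> u'" using u' vu m(3,4) by blast
  ultimately have "u \<noteq> u'" using u u' m m' ne by blast
  have "{u, u'} \<notin> E" using u \<open>v \<noteq> u'\<close> by blast
  then have "v = v' \<or> {v, v'} \<in> E"
    using assms(3) m(1) m'(1) u u' \<open>u \<noteq> u'\<close> \<open>u \<noteq> v'\<close> \<open>v \<noteq> u'\<close> edge_commute
    unfolding near_def by blast
  then show False
  proof
    assume "v = v'"
    then have "w = u'" using v vu' \<open>u \<noteq> u'\<close> by blast
    have "card {u, v, u'} \<le> 4" by (simp add: card_insert_if)
    moreover have "z \<in> {u, v, u'}" if "y \<in> {u, v, u'}" "{y, z} \<in> E" for y z
      using that u v u' \<open>w = u'\<close> \<open>v = v'\<close> by blast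
    ultimately show False
      using no_small_closed_set[of u "{u, v, u'}"] edge_ends[OF m(2)] by blast
  next
    assume vv': "{v, v'} \<in> E"
    then have "w = v'" "w' = v"
      using v v' \<open>u \<noteq> v'\<close> \<open>v \<noteq> u'\<close> edge_commute by blast+
    have "card {u, v, v', u'} \<le> 4" by (simp add: card_insert_if)
    moreover have "z \<in> {u, v, v', u'}" if "y \<in> {u, v, v', u'}" "{y, z} \<in> E" for y z
      using that u v u' v' \<open>w = v'\<close> \<open>w' = v\<close> by blast
    ultimately show False
      using no_small_closed_set[of u "{u, v, v', u'}"] edge_ends[OF m(2)] by blast
  qed
qed

section \<open>Simplicial edges are good pendant edges\<close>

lemma simplicial_good_if_leaves:
  assumes s: "simplicial E (near E) {x, y}"
    and leaves: "\<And>a z. {x, a} \<in> E \<Longrightarrow> a \<noteq> y \<Longrightarrow> {a, z} \<in> E \<Longrightarrow> z = x"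
  shows "{x, y} \<in> good_pendant_edges V E"
proof (cases "\<exists>a. {x, a} \<in> E \<and> a \<noteq> y")
  case False
  then have x: "z = y" if "{x, z} \<in> E" for z using that by blast
  have xy: "{x, y} \<in> E" using s unfolding simplicial_def by blast
  have yx: "{y, x} \<in> E" using xy by (rule edge_commute)
  \<comment> \<open>Here \<open>x\<close> is a leaf, so by reducedness no other neighbour of
    \<open>y\<close> is one.\<close>
  have branch: "\<exists>b'. {b, b'} \<in> E \<and> b' \<noteq> y" if "{y, b} \<in> E" "b \<noteq> x" for b
    using leaf_unique[OF that(1) yx] x that(2) by blast
  \<comment> \<open>Two further branches at \<open>y\<close> would contain edges
    \<open>{b, b'}\<close> and \<open>{c, c'}\<close>, both near \<open>{x, y}\<close>. Any way for
    them to be near each other closes a cycle of length at most five.\<close>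
  have unique: "b = c" if b: "{y, b} \<in> E" "b \<noteq> x" and c: "{y, c} \<in> E" "c \<noteq> x" for b c
  proof (rule ccontr)
    assume "b \<noteq> c"
    obtain b' where b': "{b, b'} \<in> E" "b' \<noteq> y" using branch[OF b] by blast
    obtain c' where c': "{c, c'} \<in> E" "c' \<noteq> y" using branch[OF c] by blast
    have "near E {x, y} {b, b'}" "near E {x, y} {c, c'}"
      using b c unfolding near_def by blast+
    then have "near E {b, b'} {c, c'}" using s b' c' unfolding simplicial_def by blast
    then consider "b = c" | "b = c'" | "b' = c" | "b' = c'" | "{b, c} \<in> E" | "{b, c'} \<in> E"
      | "{b', c} \<in> E" | "{b', c'} \<in> E"
      unfolding near_def by blast
    then show False
    proof cases
      case 1 then show ?thesis using \<open>b \<noteq> c\<close> by blast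
    next
      case 2 then show ?thesis using no_3cycle[of y c b] b c c' edge_commute by blast
    next
      case 3 then show ?thesis using no_3cycle[of y b c] b c b' edge_commute by blast
    next
      case 4 then show ?thesis
        using no_4cycle[of y b b' c] b c b' c' \<open>b \<noteq> c\<close> edge_commute by blast
    next
      case 5 then show ?thesis using no_3cycle[of y b c] b c edge_commute by blast
    next
      case 6 then show ?thesis
        using no_4cycle[of y b c' c] b c c' \<open>b \<noteq> c\<close> edge_commute by blast
    next
      case 7 then show ?thesis
        using no_4cycle[of y b b' c] b c b' \<open>b \<noteq> c\<close> edge_commute by blast
    next
      case 8 then show ?thesis using no_5cycle[of y b b' c' c] b c b' c' edge_commute by blast
    qed
  qed
  have "\<exists>w. {y, w} \<in> E \<and> w \<noteq> x"
  proof (rule ccontr)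
    assume "\<not> ?thesis"
    then have "v \<in> {x, y}" if "u \<in> {x, y}" "{u, v} \<in> E" for u v using that x by blast
    moreover have "card {x, y} \<le> 4" by (simp add: card_insert_if)
    ultimately show False using no_small_closed_set[of x "{x, y}"] edge_ends[OF xy] by blast
  qed
  then obtain w where w: "{y, w} \<in> E" "w \<noteq> x" by blast
  show ?thesis using good_pendant_edgeI[OF xy w(1)] w x unique by blast
next
  case True
  then obtain a where a: "{x, a} \<in> E" "a \<noteq> y" by blast
  have ax: "{a, x} \<in> E" using a(1) by (rule edge_commute)
  have xy: "{x, y} \<in> E" using s unfolding simplicial_def by blast
  have aleaf: "z = x" if "{a, z} \<in> E" for z using leaves a that by blast
  have x: "z = y \<or> z = a" if "{x, z} \<in> E" for z
    using leaf_unique[OF that a(1)] leaves that aleaf by blast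
  \<comment> \<open>The edges \<open>{a, x}\<close> and \<open>{b, b'}\<close> are both near
    \<open>{x, y}\<close>, but they could be near each other only through a short cycle or a second
    neighbour of the leaf \<open>a\<close>. So the remaining neighbours of \<open>y\<close> are
    leaves too, and the whole tree has at most four vertices.\<close>
  have bleaf: "b' = y" if b: "{y, b} \<in> E" "b \<noteq> x" and b': "{b, b'} \<in> E" for b b'
  proof (rule ccontr)
    assume "b' \<noteq> y"
    have "near E {x, y} {a, x}" "near E {x, y} {b, b'}"
      using b unfolding near_def by blast+
    then have "near E {a, x} {b, b'}" using s ax b' unfolding simplicial_def by blast
    then consider "a = b \<or> a = b'" | "x = b" | "x = b'" | "{a, b} \<in> E \<or> {a, b'} \<in> E"
      | "{x, b} \<in> E" | "{x, b'} \<in> E"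
      unfolding near_def by blast
    then show False
    proof cases
      case 1 then show ?thesis
        using aleaf[of y] aleaf[of b] b b' edge_commute edge_ends(3)[OF xy] by blast
    next
      case 2 then show ?thesis using b by blast
    next
      case 3 then show ?thesis using no_3cycle[of x y b] xy b b' by blast
    next
      case 4 then show ?thesis using aleaf b no_3cycle[of x y b] xy b' by blast
    next
      case 5 then show ?thesis using no_3cycle[of x y b] xy b edge_commute by blast
    next
      case 6 then show ?thesis
        using no_4cycle[of x y b b'] xy b b' \<open>b' \<noteq> y\<close> edge_commute by blast
    qed
  qed
  have bunique: "b = c" if "{y, b} \<in> E" "b \<noteq> x" "{y, c} \<in> E" "c \<noteq> x" for b c
    using leaf_unique[OF that(1,3)] bleaf that by blast
  \<comment> \<open>If \<open>y\<close> has no neighbour besides \<open>x\<close>, any value serves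
    as \<open>b\<close>.\<close>
  obtain b where b: "\<And>z. {y, z} \<in> E \<Longrightarrow> z \<noteq> x \<Longrightarrow> z = b" using bunique by metis
  have closed: "v \<in> {a, x, y} \<union> {z. {y, z} \<in> E}"
    if "u \<in> {a, x, y} \<union> {z. {y, z} \<in> E}" "{u, v} \<in> E" for u v
    using that aleaf x bleaf by blast
  have sub: "{a, x, y} \<union> {z. {y, z} \<in> E} \<subseteq> {a, x, y, b}" using b by blast
  moreover have "card {a, x, y, b} \<le> 4" by (simp add: card_insert_if)
  ultimately have "card ({a, x, y} \<union> {z. {y, z} \<in> E}) \<le> 4"
    using card_mono[OF _ sub] by simp
  moreover have "finite ({a, x, y} \<union> {z. {y, z} \<in> E})" using sub finite_subset by blast
  ultimately have False
    using no_small_closed_set[of x "{a, x, y} \<union> {z. {y, z} \<in> E}"] closed edge_ends[OF xy] by blast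
  then show ?thesis ..
qed

text \<open>If both endpoints of \<open>s\<close> had a branch of length two, the outer edges of
  these branches would be near \<open>s\<close> but, in a tree, not near each other. So at one
  endpoint all neighbours off \<open>s\<close> are leaves.\<close>

lemma simplicial_good_pendant_edge:
  assumes s: "simplicial E (near E) s"
  shows "s \<in> good_pendant_edges V E"
proof -
  have "s \<in> E" using s unfolding simplicial_def by blast
  then obtain x y where sxy: "s = {x, y}" and xy: "{x, y} \<in> E"
    using simple_graph_edgeE[OF simple] by blast
  have False if a: "{x, a} \<in> E" "a \<noteq> y" "{a, a'} \<in> E" "a' \<noteq> x"
    and b: "{y, b} \<in> E" "b \<noteq> x" "{b, b'} \<in> E" "b' \<noteq> y" for a a' b b'
  proof -
    have "near E s {a, a'}" "near E s {b, b'}"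
      using a b sxy unfolding near_def by blast+
    then have nr: "near E {a, a'} {b, b'}" using s a b unfolding simplicial_def by blast
    have ab: "a \<noteq> b" using no_3cycle[of x y b] xy a b edge_commute by blast
    have ab': "{a, b} \<notin> E" using no_4cycle[of x y b a] xy a b edge_commute by blast
    have "a \<noteq> b'" "a' \<noteq> b" using ab' a b edge_commute by blast+
    moreover have "a' \<noteq> b'" using no_5cycle[of x y b b' a] xy a b edge_commute by blast
    moreover have "{a, b'} \<notin> E" using no_5cycle[of x y b b' a] xy a b edge_commute by blast
    moreover have "{a', b} \<notin> E" using no_5cycle[of x y b a' a] xy a b edge_commute by blast
    \<comment> \<open>All other ways of being near are excluded by shorter cycles; this last one
      closes a 6-cycle.\<close>
    ultimately have "{a', b'} \<in> E" using nr ab ab' unfolding near_def by blast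
    then show False
      using no_6cycle[of x y b b' a' a] xy a b \<open>a \<noteq> b'\<close> \<open>a' \<noteq> b\<close> edge_commute by blast
  qed
  then consider "\<And>a z. {x, a} \<in> E \<Longrightarrow> a \<noteq> y \<Longrightarrow> {a, z} \<in> E \<Longrightarrow> z = x"
    | "\<And>b z. {y, b} \<in> E \<Longrightarrow> b \<noteq> x \<Longrightarrow> {b, z} \<in> E \<Longrightarrow> z = y"
    by blast
  then show ?thesis
  proof cases
    case 1
    then show ?thesis using simplicial_good_if_leaves[of x y] s sxy by blast
  next
    case 2
    have "s = {y, x}" using sxy by (simp add: insert_commute)
    then show ?thesis using simplicial_good_if_leaves[of y x] s 2 by blast
  qed
qed

lemma simplicial_iff_good_pendant_edge:
  "simplicial E (near E) s \<longleftrightarrow> s \<in> good_pendant_edges V E"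
  using good_pendant_edge_simplicial simplicial_good_pendant_edge by blast

end

theorem theorem3p7:
  fixes V :: "'a set" and E M :: "'a set set"
  assumes "tree_graph V E"
    and "reduced_graph V E"
    and "card V \<ge> 5"
    and "M = good_pendant_edges V E"
  shows "well_indumatched E \<longleftrightarrow> (\<forall>e\<in>E. \<exists>!m. m \<in> M \<and> covers V E m e)"
proof -
  interpret T: large_reduced_tree V E using assms(1-3) by unfold_locales
  interpret L: reflexive_graph E "near E" using T.simple by (rule reflexive_graph_near)
  obtain f where "perfect_elimination E (near E) f"
    using acyclic_graph_perfect_elimination[OF T.simple T.acyclic] by blast
  \<comment> \<open>Membership in \<open>M\<close> is rewritten as being simplicial, so that the
    criterion for well-covered graphs applies; its second premise is that near good pendant edges
    coincide.\<close>
  then have "well_indumatched E \<longleftrightarrow> (\<forall>e\<in>E. \<exists>!m. m \<in> M \<and> near E m e)"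
    unfolding well_indumatched_iff_well_covered assms(4)
      T.simplicial_iff_good_pendant_edge[symmetric]
    by (rule L.well_covered_iff_simplicial_partition)
      (use T.near_good_pendant_edges_eq T.simplicial_iff_good_pendant_edge in blast)
  moreover have "m \<in> M \<and> covers V E m e \<longleftrightarrow> m \<in> M \<and> near E m e" for m e
    using covers_iff_near[OF T.simple, of m e] assms(4) unfolding good_pendant_edges_def by blast
  ultimately show ?thesis by simp
qed

end
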